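(* Let $\mathcal{L}\in\mathcal{M}(N)$, $\mathcal{T}\in\mathcal{A}(N)$, let $\mathbb{A}=(\phi,\delta)$ abstract $(\mathcal{L},\mathcal{T})$, and let $(\mathcal{T},\mathbb{A})\models\mathsf{AxCmpl}$ with witness $t_{acc}$. For all states $q,q'$ of $\mathcal{L}$, every trace $s\in\mathsf{Act}^*$ and every finite $E\subseteq X$: if $q'\in\mathrm{ws}(q,s)$ then Must$\big(q,\ t_{acc}(\overline{s},\ E\setminus\mathrm{coR}_{\mathbb{A}}(q'))\big)$ does not hold. Here $\overline{s}$ is $s$ with every action replaced by its dual.
   Context: $\mathsf{Act}$ countable set of visible actions, $\tau\notin\mathsf{Act}$, $\mathsf{L}=\mathsf{Act}\cup\{\tau\}$, involutive duality $\mu\mapsto\overline{\mu}$; $N\subseteq\mathsf{Act}$ non-blocking, $B=\mathsf{Act}\setminus N$; LTSs finite-image. Axioms (all $\alpha\in\mathsf{L}$, $\eta\in N$, $\mu\in\mathsf{Act}$, $\mu\ne\eta$): N-delay: $p_1\xrightarrow{\eta}p_2\xrightarrow{\alpha}p_3\Rightarrow\exists p_4.\,p_1\xrightarrow{\alpha}p_4\xrightarrow{\eta}p_3$; N-confluence: $p_1\xrightarrow{\eta}p_2,p_1\xrightarrow{\mu}p_3\Rightarrow\exists p_4.\,p_2\xrightarrow{\mu}p_4,p_3\xrightarrow{\eta}p_4$; N-determinacy: $p_1\xrightarrow{\eta}p_2,p_1\xrightarrow{\eta}p_3\Rightarrow p_2=p_3$; backwards-N-determinacy: $p_2\xrightarrow{\eta}p_1,p_3\xrightarrow{\eta}p_1\Rightarrow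 p_2=p_3$; Fwd-Feedback: $p_1\xrightarrow{\eta}p_2\xrightarrow{\overline{\eta}}p_3\Rightarrow p_1\xrightarrow{\tau}p_3$ or $p_1=p_3$; Boomerang: each $p$ has $p'$ with $p\xrightarrow{\overline{\eta}}p'\xrightarrow{\eta}p$; N-tau: $p_1\xrightarrow{\eta}p_2,p_1\xrightarrow{\tau}p_3$ imply $\exists p_4.\,p_2\xrightarrow{\tau}p_4,p_3\xrightarrow{\eta}p_4$, or $p_2\xrightarrow{\overline{\eta}}p_3$; Feedback: $p\xrightarrow{\eta}q\xrightarrow{\overline{\eta}}q'\Rightarrow p\xrightarrow{\tau}q'$. $\mathcal{M}(N)$: LTSs with N-delay, N-confluence, N-determinacy, backwards-N-determinacy, Fwd-Feedback, Boomerang, N-tau. $\mathcal{A}(N)$: LTSs with N-delay, N-confluence, N-determinacy, backwards-N-determinacy, N-tau, Feedback. Composition of $p$ and test $t$: steps by $\tau$-moves of either side or by $p\xrightarrow{\overline{\mu}}p'$, $t\xrightarrow{\mu}t'$. good: decidable predicate on tests preserved in both directions by $N$-transitions. Must$(p,t)$ iff every maximal computation from $(p,t)$ contains a state with good test. $\mathrm{ws}(p,s)=\{q:p\overset{s}{\Rightarrow}q,\ q\not\xrightarrow{\tau}\}$ (weak transitions allow interleaved $\tau$-steps). $R(t)=\{\mu:t\xrightarrow{\mu}\}$, $\mathrm{coR}(p)=\{\beta\in B:p\xrightarrow{\overline{\beta}}\}$. Label abstraction $\mathbb{A}=(\phi:B\to Y,\delta:Y\to X)$, $\mathrm{coR}_{\mathbb{A}}(p)=\{\delta(\phi(\beta)):\beta\in\mathrm{coR}(p)\}$;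 abstracts $(\mathcal{L},\mathcal{T})$ if for all $\beta,\beta'\in B$: (i) for each test $t$, $\phi(\beta)=\phi(\beta')$, $\beta\in R(t)\Rightarrow\beta'\in R(t)$; (ii) for each $p$ in $\mathcal{L}$, $\delta(\phi(\beta))=\delta(\phi(\beta'))$, $\phi(\beta)\in\phi(\mathrm{coR}(p))\Rightarrow\phi(\beta')\in\phi(\mathrm{coR}(p))$. $(\mathcal{T},\mathbb{A})\models\mathsf{AxCmpl}$: there are $t_{cnv}:\mathsf{Act}^*\to T$, $t_{acc}:\mathsf{Act}^*\times\mathcal{P}_{fin}(X)\to T$ such that for all $s$, $\mu,\mu'\in\mathsf{Act}$, finite $E\subseteq X$, $f\in\{t_{cnv},t_{acc}(\cdot,E)\}$: (1) not good$(f(s))$; (2) $f(\mu.s)\xrightarrow{\mu}f(s)$; (3) $\mu\in B\Rightarrow f(\mu.s)\xrightarrow{\tau}$; (4) $\mu\in B$, $f(\mu.s)\xrightarrow{\tau}t\Rightarrow$ good$(t)$; (5) $\mu\in B$, $f(\mu.s)\xrightarrow{\mu}t\Rightarrow t=f(s)$; (6) $\mu\in B$, $f(\mu.s)\xrightarrow{\mu'}t$, $\mu'\ne\mu\Rightarrow$ good$(t)$; (a1) $t_{acc}(\varepsilon,E)\not\xrightarrow{\tau}$; (a2) $t_{acc}(\varepsilon,E)\not\xrightarrow{\eta}$, $\eta\in N$; (a3) $\beta\in B$, $t_{acc}(\varepsilon,E)\xrightarrow{\beta}\Rightarrow\delta(\phi(\beta))\in E$; (a4) each $e\in E$ is $\delta(\phi(\beta))$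 for some $\beta\in B$ with $t_{acc}(\varepsilon,E)\xrightarrow{\beta}$; (a5) $\beta\in B$, $t_{acc}(\varepsilon,E)\xrightarrow{\beta}t\Rightarrow$ good$(t)$; (c1) $t_{cnv}(\varepsilon)\not\xrightarrow{\mu}$, $\mu\in\mathsf{Act}$; (c2) $t_{cnv}(\varepsilon)\xrightarrow{\tau}$; (c3) $t_{cnv}(\varepsilon)\xrightarrow{\tau}t\Rightarrow$ good$(t)$. *)

theory Defs
  imports Main "HOL-Library.Countable" "HOL-Library.Extended_Nat"
begin

text \<open>
  The type \<open>'a\<close> is the set of visible actions; \<open>'a label\<close> adds the invisible action.
  The duality on visible actions is a parameter \<open>bar\<close>, and the blocking actions
  \<open>B\<close> are the complement \<open>- N\<close> of the non-blocking ones.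
\<close>

datatype 'a label = Tau | Vis 'a

type_synonym ('s, 'a) lts = "'s \<Rightarrow> 'a label \<Rightarrow> 's \<Rightarrow> bool"

definition can :: "('s, 'a) lts \<Rightarrow> 's \<Rightarrow> 'a label \<Rightarrow> bool" where
  "can tr p \<alpha> \<longleftrightarrow> (\<exists>q. tr p \<alpha> q)"

definition finite_image :: "('s, 'a) lts \<Rightarrow> bool" where
  "finite_image tr \<longleftrightarrow> (\<forall>p \<alpha>. finite {q. tr p \<alpha> q})"

definition N_delay :: "'a set \<Rightarrow> ('s, 'a) lts \<Rightarrow> bool" where
  "N_delay N tr \<longleftrightarrow> (\<forall>\<eta>\<in>N. \<forall>\<alpha> p1 p2 p3.
     tr p1 (Vis \<eta>) p2 \<longrightarrow> tr p2 \<alpha> p3 \<longrightarrow> (\<exists>p4. tr p1 \<alpha> p4 \<and> tr p4 (Vis \<eta>) p3))"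

definition N_confluence :: "'a set \<Rightarrow> ('s, 'a) lts \<Rightarrow> bool" where
  "N_confluence N tr \<longleftrightarrow> (\<forall>\<eta>\<in>N. \<forall>\<mu> p1 p2 p3. \<mu> \<noteq> \<eta> \<longrightarrow>
     tr p1 (Vis \<eta>) p2 \<longrightarrow> tr p1 (Vis \<mu>) p3 \<longrightarrow>
     (\<exists>p4. tr p2 (Vis \<mu>) p4 \<and> tr p3 (Vis \<eta>) p4))"

definition N_determinacy :: "'a set \<Rightarrow> ('s, 'a) lts \<Rightarrow> bool" where
  "N_determinacy N tr \<longleftrightarrow> (\<forall>\<eta>\<in>N. \<forall>p1 p2 p3.
     tr p1 (Vis \<eta>) p2 \<longrightarrow> tr p1 (Vis \<eta>) p3 \<longrightarrow> p2 = p3)"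

definition backwards_N_determinacy :: "'a set \<Rightarrow> ('s, 'a) lts \<Rightarrow> bool" where
  "backwards_N_determinacy N tr \<longleftrightarrow> (\<forall>\<eta>\<in>N. \<forall>p1 p2 p3.
     tr p2 (Vis \<eta>) p1 \<longrightarrow> tr p3 (Vis \<eta>) p1 \<longrightarrow> p2 = p3)"

definition Fwd_Feedback :: "('a \<Rightarrow> 'a) \<Rightarrow> 'a set \<Rightarrow> ('s, 'a) lts \<Rightarrow> bool" where
  "Fwd_Feedback bar N tr \<longleftrightarrow> (\<forall>\<eta>\<in>N. \<forall>p1 p2 p3.
     tr p1 (Vis \<eta>) p2 \<longrightarrow> tr p2 (Vis (bar \<eta>)) p3 \<longrightarrow> tr p1 Tau p3 \<or> p1 = p3)"

definition Boomerang :: "('a \<Rightarrow> 'a) \<Rightarrow> 'a set \<Rightarrow> ('s, 'a) lts \<Rightarrow> bool" where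
  "Boomerang bar N tr \<longleftrightarrow> (\<forall>\<eta>\<in>N. \<forall>p. \<exists>p'.
     tr p (Vis (bar \<eta>)) p' \<and> tr p' (Vis \<eta>) p)"

definition N_tau :: "('a \<Rightarrow> 'a) \<Rightarrow> 'a set \<Rightarrow> ('s, 'a) lts \<Rightarrow> bool" where
  "N_tau bar N tr \<longleftrightarrow> (\<forall>\<eta>\<in>N. \<forall>p1 p2 p3.
     tr p1 (Vis \<eta>) p2 \<longrightarrow> tr p1 Tau p3 \<longrightarrow>
     (\<exists>p4. tr p2 Tau p4 \<and> tr p3 (Vis \<eta>) p4) \<or> tr p2 (Vis (bar \<eta>)) p3)"

definition Feedback :: "('a \<Rightarrow> 'a) \<Rightarrow> 'a set \<Rightarrow> ('s, 'a) lts \<Rightarrow> bool" where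
  "Feedback bar N tr \<longleftrightarrow> (\<forall>\<eta>\<in>N. \<forall>p q q'.
     tr p (Vis \<eta>) q \<longrightarrow> tr q (Vis (bar \<eta>)) q' \<longrightarrow> tr p Tau q')"

definition M_class :: "('a \<Rightarrow> 'a) \<Rightarrow> 'a set \<Rightarrow> ('s, 'a) lts \<Rightarrow> bool" where
  "M_class bar N tr \<longleftrightarrow>
     finite_image tr \<and> N_delay N tr \<and> N_confluence N tr \<and> N_determinacy N tr \<and>
     backwards_N_determinacy N tr \<and> Fwd_Feedback bar N tr \<and> Boomerang bar N tr \<and>
     N_tau bar N tr"

definition A_class :: "('a \<Rightarrow> 'a) \<Rightarrow> 'a set \<Rightarrow> ('s, 'a) lts \<Rightarrow> bool" where
  "A_class bar N tr \<longleftrightarrow>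
     finite_image tr \<and> N_delay N tr \<and> N_confluence N tr \<and> N_determinacy N tr \<and>
     backwards_N_determinacy N tr \<and> N_tau bar N tr \<and> Feedback bar N tr"

definition good_N_invariant :: "'a set \<Rightarrow> ('t, 'a) lts \<Rightarrow> ('t \<Rightarrow> bool) \<Rightarrow> bool" where
  "good_N_invariant N ttr good \<longleftrightarrow>
     (\<forall>\<eta>\<in>N. \<forall>t t'. ttr t (Vis \<eta>) t' \<longrightarrow> (good t \<longleftrightarrow> good t'))"

inductive comp_step :: "('a \<Rightarrow> 'a) \<Rightarrow> ('p, 'a) lts \<Rightarrow> ('t, 'a) lts \<Rightarrow> 'p \<times> 't \<Rightarrow> 'p \<times> 't \<Rightarrow> bool"
  for bar :: "'a \<Rightarrow> 'a" and tr :: "('p, 'a) lts" and ttr :: "('t, 'a) lts" where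
  proc: "tr p Tau p' \<Longrightarrow> comp_step bar tr ttr (p, t) (p', t)"
| test: "ttr t Tau t' \<Longrightarrow> comp_step bar tr ttr (p, t) (p, t')"
| comm: "tr p (Vis (bar \<mu>)) p' \<Longrightarrow> ttr t (Vis \<mu>) t' \<Longrightarrow> comp_step bar tr ttr (p, t) (p', t')"

text \<open>
  A computation is a function \<open>c\<close> read at the indices \<open>i \<le> n\<close>, where \<open>n\<close> is its number
  of steps, possibly \<open>\<infinity>\<close>. It is maximal if it is infinite or ends in a state without steps.
\<close>

definition max_computation :: "('s \<Rightarrow> 's \<Rightarrow> bool) \<Rightarrow> 's \<Rightarrow> enat \<Rightarrow> (nat \<Rightarrow> 's) \<Rightarrow> bool" where
  "max_computation step x n c \<longleftrightarrow>
     c 0 = x \<and>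
     (\<forall>i. enat i < n \<longrightarrow> step (c i) (c (Suc i))) \<and>
     (\<forall>k. n = enat k \<longrightarrow> \<not> (\<exists>y. step (c k) y))"

definition Must :: "('a \<Rightarrow> 'a) \<Rightarrow> ('p, 'a) lts \<Rightarrow> ('t, 'a) lts \<Rightarrow> ('t \<Rightarrow> bool) \<Rightarrow> 'p \<Rightarrow> 't \<Rightarrow> bool" where
  "Must bar tr ttr good p t \<longleftrightarrow>
     (\<forall>n c. max_computation (comp_step bar tr ttr) (p, t) n c \<longrightarrow>
        (\<exists>i. enat i \<le> n \<and> good (snd (c i))))"

inductive weak :: "('s, 'a) lts \<Rightarrow> 's \<Rightarrow> 'a list \<Rightarrow> 's \<Rightarrow> bool"
  for tr :: "('s, 'a) lts" where
  refl: "weak tr p [] p"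
| tau: "tr p Tau p' \<Longrightarrow> weak tr p' s q \<Longrightarrow> weak tr p s q"
| vis: "tr p (Vis \<mu>) p' \<Longrightarrow> weak tr p' s q \<Longrightarrow> weak tr p (\<mu> # s) q"

definition ws :: "('s, 'a) lts \<Rightarrow> 's \<Rightarrow> 'a list \<Rightarrow> 's set" where
  "ws tr p s = {q. weak tr p s q \<and> \<not> can tr q Tau}"

definition R :: "('t, 'a) lts \<Rightarrow> 't \<Rightarrow> 'a set" where
  "R ttr t = {\<mu>. can ttr t (Vis \<mu>)}"

definition coR :: "('a \<Rightarrow> 'a) \<Rightarrow> 'a set \<Rightarrow> ('p, 'a) lts \<Rightarrow> 'p \<Rightarrow> 'a set" where
  "coR bar N tr p = {\<beta> \<in> - N. can tr p (Vis (bar \<beta>))}"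

text \<open>
  In a label abstraction \<open>(\<phi>, \<delta>)\<close>, \<open>\<phi>\<close> is a total function on actions that is only ever
  applied to blocking ones.
\<close>

definition coR_abs ::
  "('a \<Rightarrow> 'a) \<Rightarrow> 'a set \<Rightarrow> ('p, 'a) lts \<Rightarrow> ('a \<Rightarrow> 'y) \<Rightarrow> ('y \<Rightarrow> 'x) \<Rightarrow> 'p \<Rightarrow> 'x set" where
  "coR_abs bar N tr \<phi> \<delta> p = (\<lambda>\<beta>. \<delta> (\<phi> \<beta>)) ` coR bar N tr p"

definition abstracts ::
  "('a \<Rightarrow> 'a) \<Rightarrow> 'a set \<Rightarrow> ('a \<Rightarrow> 'y) \<Rightarrow> ('y \<Rightarrow> 'x) \<Rightarrow> ('p, 'a) lts \<Rightarrow> ('t, 'a) lts \<Rightarrow> bool" where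
  "abstracts bar N \<phi> \<delta> tr ttr \<longleftrightarrow> (\<forall>\<beta>\<in>-N. \<forall>\<beta>'\<in>-N.
     (\<forall>t. \<phi> \<beta> = \<phi> \<beta>' \<longrightarrow> \<beta> \<in> R ttr t \<longrightarrow> \<beta>' \<in> R ttr t) \<and>
     (\<forall>p. \<delta> (\<phi> \<beta>) = \<delta> (\<phi> \<beta>') \<longrightarrow> \<phi> \<beta> \<in> \<phi> ` coR bar N tr p \<longrightarrow> \<phi> \<beta>' \<in> \<phi> ` coR bar N tr p))"

definition AxCmpl_common ::
  "'a set \<Rightarrow> ('t, 'a) lts \<Rightarrow> ('t \<Rightarrow> bool) \<Rightarrow> ('a list \<Rightarrow> 't) \<Rightarrow> bool" where
  "AxCmpl_common N ttr good f \<longleftrightarrow>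
     (\<forall>s. \<not> good (f s)) \<and>
     (\<forall>\<mu> s. ttr (f (\<mu> # s)) (Vis \<mu>) (f s)) \<and>
     (\<forall>\<mu>\<in>-N. \<forall>s. can ttr (f (\<mu> # s)) Tau) \<and>
     (\<forall>\<mu>\<in>-N. \<forall>s t. ttr (f (\<mu> # s)) Tau t \<longrightarrow> good t) \<and>
     (\<forall>\<mu>\<in>-N. \<forall>s t. ttr (f (\<mu> # s)) (Vis \<mu>) t \<longrightarrow> t = f s) \<and>
     (\<forall>\<mu>\<in>-N. \<forall>\<mu>' s t. ttr (f (\<mu> # s)) (Vis \<mu>') t \<longrightarrow> \<mu>' \<noteq> \<mu> \<longrightarrow> good t)"

definition AxCmpl_acc ::
  "'a set \<Rightarrow> ('t, 'a) lts \<Rightarrow> ('t \<Rightarrow> bool) \<Rightarrow> ('a \<Rightarrow> 'y) \<Rightarrow> ('y \<Rightarrow> 'x) \<Rightarrow>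
   ('a list \<Rightarrow> 'x set \<Rightarrow> 't) \<Rightarrow> 'x set \<Rightarrow> bool" where
  "AxCmpl_acc N ttr good \<phi> \<delta> t_acc E \<longleftrightarrow>
     \<not> can ttr (t_acc [] E) Tau \<and>
     (\<forall>\<eta>\<in>N. \<not> can ttr (t_acc [] E) (Vis \<eta>)) \<and>
     (\<forall>\<beta>\<in>-N. can ttr (t_acc [] E) (Vis \<beta>) \<longrightarrow> \<delta> (\<phi> \<beta>) \<in> E) \<and>
     (\<forall>e\<in>E. \<exists>\<beta>\<in>-N. can ttr (t_acc [] E) (Vis \<beta>) \<and> e = \<delta> (\<phi> \<beta>)) \<and>
     (\<forall>\<beta>\<in>-N. \<forall>t. ttr (t_acc [] E) (Vis \<beta>) t \<longrightarrow> good t)"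

definition AxCmpl_cnv ::
  "('t, 'a) lts \<Rightarrow> ('t \<Rightarrow> bool) \<Rightarrow> ('a list \<Rightarrow> 't) \<Rightarrow> bool" where
  "AxCmpl_cnv ttr good t_cnv \<longleftrightarrow>
     (\<forall>\<mu>. \<not> can ttr (t_cnv []) (Vis \<mu>)) \<and>
     can ttr (t_cnv []) Tau \<and>
     (\<forall>t. ttr (t_cnv []) Tau t \<longrightarrow> good t)"

text \<open>
  The acceptance tests are indexed by finite sets: \<open>t_acc\<close> is constrained only on those.
\<close>

definition AxCmpl_witness ::
  "'a set \<Rightarrow> ('t, 'a) lts \<Rightarrow> ('t \<Rightarrow> bool) \<Rightarrow> ('a \<Rightarrow> 'y) \<Rightarrow> ('y \<Rightarrow> 'x) \<Rightarrow>
   ('a list \<Rightarrow> 't) \<Rightarrow> ('a list \<Rightarrow> 'x set \<Rightarrow> 't) \<Rightarrow> bool" where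
  "AxCmpl_witness N ttr good \<phi> \<delta> t_cnv t_acc \<longleftrightarrow>
     AxCmpl_common N ttr good t_cnv \<and>
     AxCmpl_cnv ttr good t_cnv \<and>
     (\<forall>E. finite E \<longrightarrow>
        AxCmpl_common N ttr good (\<lambda>s. t_acc s E) \<and> AxCmpl_acc N ttr good \<phi> \<delta> t_acc E)"

end

theory Submission
  imports Defs
begin

text \<open>
  Along \<open>q \<Rightarrow> q'\<close> every visible action of the process is matched by the test, which moves through
  its tests \<open>t_acc\<close> for the remaining suffixes of the trace. None of these is good. The computation
  ends in \<open>q'\<close> against \<open>t_acc [] (E - coR_abs q')\<close>, which is stuck: the final test offers only blocking
  actions whose abstraction lies outside \<open>coR_abs q'\<close>.
\<close>

lemma not_Must_stuck:
  assumes "\<not> good t" and "\<And>y. \<not> comp_step bar tr ttr (p, t) y"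
  shows "\<not> Must bar tr ttr good p t"
proof -
  have "max_computation (comp_step bar tr ttr) (p, t) 0 (\<lambda>_. (p, t))"
    using assms(2) by (auto simp: max_computation_def zero_enat_def)
  with assms(1) show ?thesis
    unfolding Must_def by fastforce
qed

text \<open>\<open>Must\<close> quantifies over all maximal computations, so one bad successor
  suffices: a maximal computation that avoids good tests still avoids them when a step from a
  non-good test is put in front.\<close>

lemma not_Must_step:
  assumes "\<not> good t" and step: "comp_step bar tr ttr (p, t) (p', t')"
    and "\<not> Must bar tr ttr good p' t'"
  shows "\<not> Must bar tr ttr good p t"
proof -
  from assms(3) obtain n c
    where c: "max_computation (comp_step bar tr ttr) (p', t') n c"
      and bad: "\<And>i. enat i \<le> n \<Longrightarrow> \<not> good (snd (c i))"
    unfolding Must_def by blast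
  \<comment> \<open>\<open>d\<close> is \<open>c\<close> shifted by one index, of length
    \<open>eSuc n\<close>. As \<open>eSuc\<close> fixes infinity, finite and infinite computations
    are treated alike.\<close>
  define d where "d = case_nat (p, t) c"
  have Suc_iff: "enat (Suc i) < eSuc n \<longleftrightarrow> enat i < n" "enat (Suc i) \<le> eSuc n \<longleftrightarrow> enat i \<le> n" for i
    by (simp_all flip: eSuc_enat)
  have "max_computation (comp_step bar tr ttr) (p, t) (eSuc n) d"
    unfolding max_computation_def
  proof (intro conjI allI impI)
    show "d 0 = (p, t)"
      by (simp add: d_def)
  next
    fix i assume "enat i < eSuc n"
    then show "comp_step bar tr ttr (d i) (d (Suc i))"
      using c step Suc_iff(1) by (cases i) (auto simp: d_def max_computation_def)
  next
    fix k assume "eSuc n = enat k"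
    then obtain m where "n = enat m" "k = Suc m"
      by (cases n) (auto simp: eSuc_enat)
    then show "\<not> (\<exists>y. comp_step bar tr ttr (d k) y)"
      using c by (simp add: d_def max_computation_def)
  qed
  moreover have "\<not> good (snd (d i))" if "enat i \<le> eSuc n" for i
    using that assms(1) bad Suc_iff(2) by (cases i) (auto simp: d_def)
  ultimately show ?thesis
    unfolding Must_def by blast
qed

text \<open>The family \<open>f\<close> is indexed by the trace still to be performed, so the
  induction on the weak transition peels off one test per visible action. The end state
  \<open>p'\<close> stays fixed throughout, which lets \<open>f\<close> depend on it.\<close>

lemma not_Must_weak:
  assumes "weak tr p s p'" and "\<And>\<mu>. bar (bar \<mu>) = \<mu>"
    and "\<And>s. \<not> good (f s)" and "\<And>\<mu> s. ttr (f (\<mu> # s)) (Vis \<mu>) (f s)"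
    and "\<not> Must bar tr ttr good p' (f [])"
  shows "\<not> Must bar tr ttr good p (f (map bar s))"
  using assms(1,5)
proof (induction rule: weak.induct)
  case (refl p)
  then show ?case by simp
next
  case (tau p p' s q)
  have "comp_step bar tr ttr (p, f (map bar s)) (p', f (map bar s))"
    using tau.hyps(1) by (rule comp_step.proc)
  from not_Must_step[where good = good, OF _ this] show ?case
    using tau.IH tau.prems assms(3) by simp
next
  case (vis p \<mu> p' s q)
  \<comment> \<open>The test performs \<open>bar \<mu>\<close>, so its partner must perform
    \<open>bar (bar \<mu>)\<close>, which is \<open>\<mu>\<close> by involutivity.\<close>
  have "comp_step bar tr ttr (p, f (bar \<mu> # map bar s)) (p', f (map bar s))"
    using vis.hyps(1) assms(2,4) by (intro comp_step.comm[where \<mu> = "bar \<mu>"]) simp_all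
  from not_Must_step[where good = good, OF _ this] show ?case
    using vis.IH vis.prems assms(3) by simp
qed

lemma t_acc_Nil_stuck:
  assumes "AxCmpl_acc N ttr good \<phi> \<delta> t_acc E" and "\<not> can tr p Tau"
    and "E \<inter> coR_abs bar N tr \<phi> \<delta> p = {}"
  shows "\<not> comp_step bar tr ttr (p, t_acc [] E) y"
proof
  assume "comp_step bar tr ttr (p, t_acc [] E) y"
  then show False
  proof cases
    case (proc p')
    with assms(2) show False by (auto simp: can_def)
  next
    case (test t')
    with assms(1) show False by (auto simp: AxCmpl_acc_def can_def)
  next
    case (comm \<mu> p' t')
    \<comment> \<open>The final test offers no non-blocking action, and each blocking one it offers
      is abstracted into \<open>E\<close>.\<close>
    then have "\<mu> \<notin> N" "\<delta> (\<phi> \<mu>) \<in> E"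
      using assms(1) by (auto simp: AxCmpl_acc_def can_def)
    \<comment> \<open>The process side of the communication is a move on \<open>bar \<mu>\<close>
      with \<open>\<mu>\<close> blocking, which is membership of \<open>\<mu>\<close> in
      \<open>coR\<close>.\<close>
    moreover from this comm have "\<delta> (\<phi> \<mu>) \<in> coR_abs bar N tr \<phi> \<delta> p"
      by (auto simp: coR_abs_def coR_def can_def)
    ultimately show False
      using assms(3) by blast
  qed
qed

theorem lemma24:
  fixes bar :: "'a::countable \<Rightarrow> 'a"
    and N :: "'a set"
    and tr :: "('p, 'a) lts"
    and ttr :: "('t, 'a) lts"
    and good :: "'t \<Rightarrow> bool"
    and \<phi> :: "'a \<Rightarrow> 'y"
    and \<delta> :: "'y \<Rightarrow> 'x"
    and t_cnv :: "'a list \<Rightarrow> 't"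
    and t_acc :: "'a list \<Rightarrow> 'x set \<Rightarrow> 't"
    and q q' :: 'p
    and s :: "'a list"
    and E :: "'x set"
  assumes "\<And>\<mu>. bar (bar \<mu>) = \<mu>"
    and "M_class bar N tr"
    and "A_class bar N ttr"
    and "good_N_invariant N ttr good"
    and "abstracts bar N \<phi> \<delta> tr ttr"
    and "AxCmpl_witness N ttr good \<phi> \<delta> t_cnv t_acc"
    and "finite E"
    and "q' \<in> ws tr q s"
  shows "\<not> Must bar tr ttr good q (t_acc (map bar s) (E - coR_abs bar N tr \<phi> \<delta> q'))"
proof -
  let ?E = "E - coR_abs bar N tr \<phi> \<delta> q'"
  \<comment> \<open>The axioms speak of finite index sets only; \<open>?E\<close> is finite as a
    subset of \<open>E\<close>.\<close>
  have common: "AxCmpl_common N ttr good (\<lambda>s. t_acc s ?E)"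
    and acc: "AxCmpl_acc N ttr good \<phi> \<delta> t_acc ?E"
    using assms(6,7) by (simp_all add: AxCmpl_witness_def)
  have bad: "\<not> good (t_acc s ?E)" and move: "ttr (t_acc (\<mu> # s) ?E) (Vis \<mu>) (t_acc s ?E)" for \<mu> s
    using common by (simp_all add: AxCmpl_common_def)
  have weak: "weak tr q s q'" and stable: "\<not> can tr q' Tau"
    using assms(8) by (simp_all add: ws_def)
  have "\<not> Must bar tr ttr good q' (t_acc [] ?E)"
    using bad t_acc_Nil_stuck[OF acc stable] by (intro not_Must_stuck) auto
  then show ?thesis
    using not_Must_weak[OF weak assms(1), where f = "\<lambda>s. t_acc s ?E" and ttr = ttr and good = good,
      OF bad move] by simp
qed

end
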